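(* Let $n\ge 3$ and let $P_1=(x_1,y_1),\dots,P_n=(x_n,y_n)$ be $n$ distinct points in $\mathbb{R}^2$. Suppose that the sequence $(y_i)_{i=1}^n$ is convex, and let $m\in\{1,\dots,n\}$ be such that $\min_{1\le i\le n}y_i=y_m$. Suppose that the sequence $(x_i)_{i=1}^n$ is increasing, that $(x_i)_{i=1}^m$ is convex, and that $(x_i)_{i=m}^n$ is concave. Then the points $P_1,\dots,P_n$ form a convex polygon.
   Context: A finite real sequence $(u_i)_{i=a}^b$ is convex if $2u_i\le u_{i-1}+u_{i+1}$ for all $a<i<b$, and concave if the reverse inequality holds for all such $i$ (sequences with at most two terms are both convex and concave). "Increasing" means non-decreasing ($u_i\le u_{i+1}$). $\overline{PQ}$ denotes the closed line segment with endpoints $P,Q$. The points $P_1,\dots,P_n$ are said to form a convex polygon if the union of the segments $\overline{P_1P_2},\dots,\overline{P_{n-1}P_n},\overline{P_nP_1}$ equals the topological boundary (in $\mathbb{R}^2$) of the convex hull of $\{P_1,\dots,P_n\}$. Degenerate cases are allowed: consecutive vertices may be collinear with their neighbours, and all points may even lie on one line, in which case the convex hull is a segment equal to its own boundary. *)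

theory Defs
  imports "HOL-Analysis.Analysis"
begin

text \<open>
  A finite sequence \<open>(u\<^sub>i)\<close> with \<open>a \<le> i \<le> b\<close> is a function on \<open>nat\<close> of which only the values on
  \<open>{a..b}\<close> matter. The guard \<open>a < i\<close> makes the subtraction \<open>i - 1\<close> a genuine one.
\<close>

definition convex_seq :: "nat \<Rightarrow> nat \<Rightarrow> (nat \<Rightarrow> real) \<Rightarrow> bool" where
  "convex_seq a b u \<longleftrightarrow> (\<forall>i. a < i \<and> i < b \<longrightarrow> 2 * u i \<le> u (i - 1) + u (i + 1))"

definition concave_seq :: "nat \<Rightarrow> nat \<Rightarrow> (nat \<Rightarrow> real) \<Rightarrow> bool" where
  "concave_seq a b u \<longleftrightarrow> (\<forall>i. a < i \<and> i < b \<longrightarrow> 2 * u i \<ge> u (i - 1) + u (i + 1))"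

definition increasing_seq :: "nat \<Rightarrow> nat \<Rightarrow> (nat \<Rightarrow> real) \<Rightarrow> bool" where
  "increasing_seq a b u \<longleftrightarrow> (\<forall>i. a \<le> i \<and> i < b \<longrightarrow> u i \<le> u (i + 1))"

text \<open>
  The boundary is the topological one in the plane, not the relative one, so for collinear points
  the right-hand side is the whole convex hull.
\<close>

definition form_convex_polygon :: "nat \<Rightarrow> (nat \<Rightarrow> real \<times> real) \<Rightarrow> bool" where
  "form_convex_polygon n P \<longleftrightarrow>
     (\<Union>i\<in>{1..<n}. closed_segment (P i) (P (i + 1))) \<union> closed_segment (P n) (P 1)
       = frontier (convex hull (P ` {1..n}))"

end

theory Submission
  imports Defs
begin

text \<open>
  Along the sequence the edge vectors \<open>P\<^sub>i\<^sub>+\<^sub>1 - P\<^sub>i\<close> stay in the right half-plane and their direction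
  turns counterclockwise, from at worst straight down to at worst straight up: before \<open>m\<close> the
  horizontal components grow while the vertical ones are nonpositive and grow; after \<open>m\<close> the
  horizontal ones shrink while the vertical ones are nonnegative and grow; and an edge before \<open>m\<close>
  never rises while one after \<open>m\<close> never falls. So the cross product of any edge with a later one is
  nonnegative (lemma \<open>cross_edges_nonneg\<close>), and by summation every triple \<open>P\<^sub>i, P\<^sub>j, P\<^sub>k\<close> with
  \<open>i \<le> j \<le> k\<close> is a left turn in the weak sense (lemma \<open>left_turn_of_edges\<close>). This orientation
  condition on triples, together with distinctness, is all that a convex polygon needs
  (theorem \<open>left_turns_form_convex_polygon\<close>).

  For that criterion, each edge has the whole point set on one side of its line, hence lies in the
  frontier of the hull. Conversely, take a supporting line at a frontier point \<open>z\<close>. It meets the hull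
  in the hull of the vertices that it contains, so \<open>z\<close> is on a segment from \<open>P\<^sub>j\<close> to \<open>P\<^sub>k\<close> with both
  ends on the line. One of the two arcs of the closed polygonal path between \<open>P\<^sub>j\<close> and \<open>P\<^sub>k\<close> has all
  its vertices on the line: otherwise one vertex of each arc would lie strictly on the inner side
  of the line, whereas the orientations put the two arcs on different sides. A path inside a line
  covers the segment between its ends, so \<open>z\<close> is on an edge. This argument is
  uniform in all degenerate configurations, including the collinear one.
\<close>

section \<open>Orientation in the plane\<close>

definition cross2 :: "real \<times> real \<Rightarrow> real \<times> real \<Rightarrow> real" where
  "cross2 u v = fst u * snd v - snd u * fst v"

lemma cross2_add_left: "cross2 (u + v) w = cross2 u w + cross2 v w"
  and cross2_add_right: "cross2 w (u + v) = cross2 w u + cross2 w v"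
  by (simp_all add: cross2_def algebra_simps)

definition left_turn :: "real \<times> real \<Rightarrow> real \<times> real \<Rightarrow> real \<times> real \<Rightarrow> bool" where
  "left_turn A B C \<longleftrightarrow> 0 \<le> cross2 (B - A) (C - B)"

lemma left_turn_rotate: "left_turn A B C \<longleftrightarrow> left_turn B C A"
  by (simp add: left_turn_def cross2_def algebra_simps)

text \<open>
  With \<open>P\<^sub>j - P\<^sub>i\<close> and \<open>P\<^sub>k - P\<^sub>j\<close> written as sums of edge vectors, their cross product is a sum of
  cross products of an edge with a later one.
\<close>

lemma left_turn_of_edges:
  fixes P :: "nat \<Rightarrow> real \<times> real"
  assumes edges: "\<And>p q. a \<le> p \<Longrightarrow> p < q \<Longrightarrow> q < b \<Longrightarrow>
      0 \<le> cross2 (P (p + 1) - P p) (P (q + 1) - P q)"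
    and "a \<le> i" "i \<le> j" "j \<le> k" "k \<le> b"
  shows "left_turn (P i) (P j) (P k)"
proof -
  have chord_edge: "0 \<le> cross2 (P j - P i) (P (q + 1) - P q)" if "j \<le> q" "q < b" for q
    using \<open>i \<le> j\<close> that
  proof (induction j rule: dec_induct)
    case base
    then show ?case by (simp add: cross2_def)
  next
    case (step p)
    have split: "P (Suc p) - P i = (P p - P i) + (P (p + 1) - P p)" by simp
    show ?case
      unfolding split cross2_add_left
      using step edges[of p q] \<open>a \<le> i\<close> by (intro add_nonneg_nonneg) auto
  qed
  have "0 \<le> cross2 (P j - P i) (P k - P j)"
    using \<open>j \<le> k\<close> \<open>k \<le> b\<close>
  proof (induction k rule: dec_induct)
    case base
    then show ?case by (simp add: cross2_def)
  next
    case (step q)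
    have split: "P (Suc q) - P j = (P q - P j) + (P (q + 1) - P q)" by simp
    show ?case
      unfolding split cross2_add_right
      using step chord_edge[of q] by (intro add_nonneg_nonneg) auto
  qed
  then show ?thesis by (simp add: left_turn_def)
qed

section \<open>Points on a line\<close>

lemma collinear_hyperplane_plane:
  fixes a :: "real \<times> real"
  assumes "a \<noteq> 0"
  shows "collinear {w. a \<bullet> w = c}"
  using assms by (simp add: collinear_aff_dim)

lemma closed_segment_subset_via_collinear:
  fixes A :: "'a::euclidean_space"
  assumes "collinear {A, B, C}"
  shows "closed_segment A C \<subseteq> closed_segment A B \<union> closed_segment B C"
proof -
  consider "A \<in> closed_segment B C" | "B \<in> closed_segment A C" | "C \<in> closed_segment A B"
    using assms
    by (auto simp: collinear_between_cases between_mem_segment closed_segment_commute)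
  then show ?thesis
  proof cases
    case 1
    then have "closed_segment A C \<subseteq> closed_segment B C" by (simp add: subset_closed_segment)
    then show ?thesis by blast
  next
    case 2
    then show ?thesis using Un_closed_segment by blast
  next
    case 3
    then have "closed_segment A C \<subseteq> closed_segment A B" by (simp add: subset_closed_segment)
    then show ?thesis by blast
  qed
qed

text \<open>
  A path inside a line may run back and forth, but it cannot jump over a point. The starting point
  is inserted for the trivial path \<open>j = k\<close>, which has no edges.
\<close>

lemma closed_segment_subset_collinear_path:
  fixes Q :: "nat \<Rightarrow> 'a::euclidean_space"
  assumes "collinear H" "j \<le> k" "\<And>i. j \<le> i \<Longrightarrow> i \<le> k \<Longrightarrow> Q i \<in> H"
  shows "closed_segment (Q j) (Q k) \<subseteq>
    insert (Q j) (\<Union>i\<in>{j..<k}. closed_segment (Q i) (Q (i + 1)))"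
  using assms(2,3)
proof (induction k rule: dec_induct)
  case base
  then show ?case by simp
next
  case (step k)
  have "collinear {Q j, Q k, Q (Suc k)}"
    by (rule collinear_subset[OF \<open>collinear H\<close>]) (use step in auto)
  then have "closed_segment (Q j) (Q (Suc k)) \<subseteq>
      closed_segment (Q j) (Q k) \<union> closed_segment (Q k) (Q (k + 1))"
    using closed_segment_subset_via_collinear by force
  moreover have "closed_segment (Q j) (Q k) \<subseteq>
    insert (Q j) (\<Union>i\<in>{j..<k}. closed_segment (Q i) (Q (i + 1)))"
    by (rule step.IH) (use step.prems in auto)
  moreover have "{j..<Suc k} = insert k {j..<k}"
    using step.hyps by auto
  ultimately show ?case by auto
qed

lemma convex_hull_collinear_segment:
  fixes S :: "'a::euclidean_space set"
  assumes "collinear S" "z \<in> convex hull S"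
  obtains A C where "A \<in> S" "C \<in> S" "z \<in> closed_segment A C"
proof -
  obtain T where T: "finite T" "T \<subseteq> S" "int (card T) \<le> aff_dim S + 1" "z \<in> convex hull T"
    using assms(2) unfolding caratheodory_aff_dim[of S] by blast
  have "card T \<le> 2"
    using T(3) assms(1) by (simp add: collinear_aff_dim)
  moreover have "card T \<noteq> 0"
    using T(1,4) by auto
  ultimately have "card T = 1 \<or> card T = 2" by linarith
  then obtain A C where "T = {A, C}"
    by (metis card_1_singletonE card_2_iff insert_absorb2)
  then show ?thesis
    using that[of A C] T(2,4) by (simp add: segment_convex_hull)
qed

section \<open>Supporting lines of a convex hull\<close>

text \<open>
  A frontier point of a convex set with nonempty interior is a relative frontier point; if the
  interior is empty, a hyperplane containing the whole set supports it everywhere.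
\<close>

lemma supporting_hyperplane_frontier:
  fixes S :: "'a::euclidean_space set"
  assumes "convex S" "z \<in> frontier S"
  obtains a where "a \<noteq> 0" "\<And>w. w \<in> closure S \<Longrightarrow> a \<bullet> z \<le> a \<bullet> w"
proof (cases "interior S = {}")
  case True
  then obtain a b where ab: "a \<noteq> 0" "S \<subseteq> {x. a \<bullet> x = b}"
    using empty_interior_subset_hyperplane[OF assms(1)] by blast
  then have "closure S \<subseteq> {x. a \<bullet> x = b}"
    by (simp add: closure_minimal closed_hyperplane)
  moreover have "z \<in> closure S"
    using assms(2) by (simp add: frontier_def)
  ultimately show ?thesis
    using that[of a] ab(1) by (simp add: subset_iff)
next
  case False
  then have "z \<in> closure S" "z \<notin> rel_interior S"
    using assms(2) by (auto simp: frontier_def rel_interior_nonempty_interior)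
  then show ?thesis
    using supporting_hyperplane_relative_frontier[OF assms(1)] that by blast
qed

lemma supporting_edge_subset_frontier:
  assumes "A \<in> S" "B \<in> S" "A \<noteq> B" "\<And>C. C \<in> S \<Longrightarrow> left_turn A B C"
  shows "closed_segment A B \<subseteq> frontier (convex hull S)"
proof
  fix z assume z: "z \<in> closed_segment A B"
  \<comment> \<open>The inner normal of the directed edge, so that \<open>normal \<bullet> w = cross2 (B - A) w\<close>.\<close>
  define normal where "normal = (- snd (B - A), fst (B - A))"
  have "normal \<noteq> 0"
    using \<open>A \<noteq> B\<close> by (auto simp: normal_def prod_eq_iff)
  have dot: "normal \<bullet> w = cross2 (B - A) w" for w
    by (cases w) (simp add: normal_def cross2_def algebra_simps)
  have AB: "normal \<bullet> A = normal \<bullet> B"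
    by (simp add: dot) (simp add: cross2_def algebra_simps)
  have "S \<subseteq> {w. normal \<bullet> w \<ge> normal \<bullet> A}"
    using assms(4) unfolding AB
    by (auto simp: left_turn_def dot[symmetric] inner_diff_right)
  then have "convex hull S \<subseteq> {w. normal \<bullet> w \<ge> normal \<bullet> A}"
    by (simp add: hull_minimal convex_halfspace_ge)
  then have "interior (convex hull S) \<subseteq> {w. normal \<bullet> w > normal \<bullet> A}"
    using interior_mono interior_halfspace_ge[OF \<open>normal \<noteq> 0\<close>] by metis
  moreover have "closed_segment A B \<subseteq> {w. normal \<bullet> w = normal \<bullet> A}"
    by (rule closed_segment_subset) (use AB in \<open>auto simp: convex_hyperplane\<close>)
  moreover have "closed_segment A B \<subseteq> convex hull S"
    using assms(1,2) by (intro closed_segment_subset) (auto simp: hull_inc)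
  ultimately have "z \<in> interior (convex hull S) \<Longrightarrow> normal \<bullet> A < normal \<bullet> z"
    "normal \<bullet> z = normal \<bullet> A" "z \<in> convex hull S"
    using z by blast+
  then have "z \<notin> interior (convex hull S)" "z \<in> convex hull S"
    by auto
  then show "z \<in> frontier (convex hull S)"
    using closure_subset[of "convex hull S"] unfolding frontier_def by blast
qed

text \<open>
  The supporting line meets the hull in a face, and a face of a hull is spanned by the generating
  points in it.
\<close>

lemma frontier_convex_hull_on_supporting_chord:
  fixes S :: "(real \<times> real) set"
  assumes "finite S" "z \<in> frontier (convex hull S)"
  obtains a A C where "a \<noteq> 0" "\<forall>w\<in>S. a \<bullet> z \<le> a \<bullet> w"
    "A \<in> S" "C \<in> S" "a \<bullet> A = a \<bullet> z" "a \<bullet> C = a \<bullet> z" "z \<in> closed_segment A C"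
proof -
  let ?K = "convex hull S"
  have "compact S" using assms(1) by (rule finite_imp_compact)
  then have "closed ?K" by (simp add: compact_convex_hull compact_imp_closed)
  then have "z \<in> ?K" using assms(2) frontier_subset_eq by blast
  obtain a where a: "a \<noteq> 0" "\<And>w. w \<in> ?K \<Longrightarrow> a \<bullet> z \<le> a \<bullet> w"
    using supporting_hyperplane_frontier[OF convex_convex_hull assms(2)] closure_subset
    by (metis subsetD)
  let ?L = "{w. a \<bullet> w = a \<bullet> z}"
  have "?K \<inter> ?L face_of ?K"
    by (rule face_of_Int_supporting_hyperplane_ge[OF convex_convex_hull a(2)])
  then obtain S' where S': "S' \<subseteq> S" "?K \<inter> ?L = convex hull S'"
    using face_of_convex_hull_subset[OF \<open>compact S\<close>] by blast
  then have "S' \<subseteq> ?L" using S'(2) hull_subset[of S' convex] by blast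
  then have "collinear S'"
    using collinear_subset[OF collinear_hyperplane_plane[OF a(1)]] by blast
  moreover have "z \<in> convex hull S'" using S'(2) \<open>z \<in> ?K\<close> by blast
  ultimately obtain A C where "A \<in> S'" "C \<in> S'" "z \<in> closed_segment A C"
    by (rule convex_hull_collinear_segment)
  then show ?thesis
    using that[of a A C] a S'(1) \<open>S' \<subseteq> ?L\<close> by (auto simp: hull_inc)
qed

section \<open>A criterion for convex polygons\<close>

text \<open>
  The first turn puts \<open>A\<close> weakly to the right of the directed line from \<open>B\<close> to \<open>C\<close>, the second puts
  \<open>D\<close> weakly to its left, so they cannot both lie strictly on the side that \<open>a\<close> points to.
\<close>

lemma left_turns_opposite_sides:
  assumes "a \<bullet> B = c" "a \<bullet> C = c" "B \<noteq> C"
    and "left_turn B A C" "left_turn B C D"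
  shows "\<not> (c < a \<bullet> A \<and> c < a \<bullet> D)"
proof
  assume *: "c < a \<bullet> A \<and> c < a \<bullet> D"
  obtain p q where a: "a = (p, q)" by (cases a)
  define u where "u = (- q, p)"
  have "a \<noteq> 0" using * assms(1) by auto
  then have pq: "p * p + q * q > 0"
    unfolding a by (simp add: sum_squares_gt_zero_iff zero_prod_def)
  define t where "t = ((C - B) \<bullet> u) / (p * p + q * q)"
  have perp: "p * fst (C - B) + q * snd (C - B) = 0"
    using assms(1,2) a by (cases B, cases C) (simp add: algebra_simps)
  \<comment> \<open>The direction of the line is a multiple of \<open>u\<close>, the normal turned by a right angle.\<close>
  have CB: "C - B = t *\<^sub>R u"
  proof -
    obtain d e where de: "C - B = (d, e)" by (cases "C - B")
    have pe: "p * d + q * e = 0" using perp de by simp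
    have t: "t * (p * p + q * q) = p * e - q * d"
      using pq by (simp add: t_def de u_def)
    have "(p * p + q * q) * d = (p * p + q * q) * (- (t * q))"
      using pe t by algebra
    then have "d = - (t * q)" using pq by (subst (asm) mult_left_cancel) auto
    moreover have "(p * p + q * q) * e = (p * p + q * q) * (t * p)"
      using pe t by algebra
    then have "e = t * p" using pq by (subst (asm) mult_left_cancel) auto
    ultimately show ?thesis by (simp add: de u_def)
  qed
  have "t \<noteq> 0" using CB \<open>B \<noteq> C\<close> by auto
  have cross_u: "cross2 w (t *\<^sub>R u) = t * (a \<bullet> w)" for w
    by (cases w) (simp add: cross2_def u_def a algebra_simps)
  have "cross2 (A - B) (C - A) = cross2 (A - B) (C - B)"
    by (simp add: cross2_def algebra_simps)
  then have "0 \<le> t * (a \<bullet> (A - B))"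
    using assms(4) by (simp add: left_turn_def CB cross_u)
  moreover have "cross2 (C - B) (D - C) = - cross2 (D - C) (C - B)"
    by (simp add: cross2_def algebra_simps)
  then have "t * (a \<bullet> (D - C)) \<le> 0"
    using assms(5) by (simp add: left_turn_def CB cross_u)
  moreover have "0 < a \<bullet> (A - B)" "0 < a \<bullet> (D - C)"
    using * assms(1,2) by (auto simp: inner_diff_right)
  ultimately show False
    using \<open>t \<noteq> 0\<close> by (simp add: zero_le_mult_iff mult_le_0_iff)
qed

definition perimeter :: "nat \<Rightarrow> (nat \<Rightarrow> 'a::real_vector) \<Rightarrow> 'a set" where
  "perimeter n P =
     (\<Union>i\<in>{1..<n}. closed_segment (P i) (P (i + 1))) \<union> closed_segment (P n) (P 1)"

lemma vertex_in_perimeter: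
  assumes "i \<in> {1..n}"
  shows "P i \<in> perimeter n P"
  using assms by (cases "i = n") (auto simp: perimeter_def)

lemma path_subset_perimeter:
  assumes "1 \<le> j" "j \<le> n" "k \<le> n"
  shows "insert (P j) (\<Union>i\<in>{j..<k}. closed_segment (P i) (P (i + 1))) \<subseteq> perimeter n P"
proof -
  have "(\<Union>i\<in>{j..<k}. closed_segment (P i) (P (i + 1))) \<subseteq>
      (\<Union>i\<in>{1..<n}. closed_segment (P i) (P (i + 1)))"
    by (rule UN_mono) (use assms in auto)
  then show ?thesis
    using assms vertex_in_perimeter[of j n P] unfolding perimeter_def by auto
qed

text \<open>
  The indices other than \<open>j\<close> and \<open>k\<close> fall into an inner arc between them and an outer arc that
  passes through the closing edge. If the inner arc leaves the supporting line, the orientations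
  force the whole outer arc to stay on it, and the chord is covered by the arc that stays.
\<close>

lemma supporting_chord_subset_perimeter:
  fixes P :: "nat \<Rightarrow> real \<times> real"
  assumes turns: "\<And>i j k. 1 \<le> i \<Longrightarrow> i \<le> j \<Longrightarrow> j \<le> k \<Longrightarrow> k \<le> n \<Longrightarrow> left_turn (P i) (P j) (P k)"
    and "a \<noteq> 0" and supp: "\<And>i. i \<in> {1..n} \<Longrightarrow> c \<le> a \<bullet> P i"
    and jk: "1 \<le> j" "j < k" "k \<le> n" and ends: "a \<bullet> P j = c" "a \<bullet> P k = c" "P j \<noteq> P k"
  shows "closed_segment (P j) (P k) \<subseteq> perimeter n P"
proof -
  let ?L = "{w. a \<bullet> w = c}"
  have L: "collinear ?L" using \<open>a \<noteq> 0\<close> by (rule collinear_hyperplane_plane)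
  show ?thesis
  proof (cases "\<forall>i\<in>{j..k}. a \<bullet> P i = c")
    case True
    have "closed_segment (P j) (P k) \<subseteq>
        insert (P j) (\<Union>i\<in>{j..<k}. closed_segment (P i) (P (i + 1)))"
      by (rule closed_segment_subset_collinear_path[OF L]) (use True jk in auto)
    also have "\<dots> \<subseteq> perimeter n P"
      by (rule path_subset_perimeter) (use jk in auto)
    finally show ?thesis .
  next
    case False
    then obtain i where i: "j \<le> i" "i \<le> k" "a \<bullet> P i \<noteq> c" by auto
    have inner: "c < a \<bullet> P i" using supp[of i] i jk by auto
    have outer: "a \<bullet> P l = c" if l: "l \<in> {1..j} \<union> {k..n}" for l
    proof (rule ccontr)
      assume "a \<bullet> P l \<noteq> c"
      then have "c < a \<bullet> P l" using supp[of l] l jk by auto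
      moreover have "left_turn (P j) (P k) (P l)"
        using l turns[of j k l] turns[of l j k] jk left_turn_rotate by auto
      ultimately show False
        using left_turns_opposite_sides[OF ends] turns[of j i k] i jk inner by auto
    qed
    have "closed_segment (P 1) (P j) \<subseteq>
        insert (P 1) (\<Union>i\<in>{1..<j}. closed_segment (P i) (P (i + 1)))"
      by (rule closed_segment_subset_collinear_path[OF L]) (use outer jk in auto)
    also have "\<dots> \<subseteq> perimeter n P"
      by (rule path_subset_perimeter) (use jk in auto)
    finally have first: "closed_segment (P 1) (P j) \<subseteq> perimeter n P" .
    have "closed_segment (P k) (P n) \<subseteq>
        insert (P k) (\<Union>i\<in>{k..<n}. closed_segment (P i) (P (i + 1)))"
      by (rule closed_segment_subset_collinear_path[OF L]) (use outer jk in auto)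
    also have "\<dots> \<subseteq> perimeter n P"
      by (rule path_subset_perimeter) (use jk in auto)
    finally have last: "closed_segment (P k) (P n) \<subseteq> perimeter n P" .
    have on_L: "P 1 \<in> ?L" "P j \<in> ?L" "P k \<in> ?L" "P n \<in> ?L" using outer jk by auto
    have "closed_segment (P j) (P k) \<subseteq> closed_segment (P j) (P 1) \<union> closed_segment (P 1) (P k)"
      by (rule closed_segment_subset_via_collinear, rule collinear_subset[OF L]) (use on_L in auto)
    moreover have "closed_segment (P 1) (P k) \<subseteq> closed_segment (P 1) (P n) \<union> closed_segment (P n) (P k)"
      by (rule closed_segment_subset_via_collinear, rule collinear_subset[OF L]) (use on_L in auto)
    moreover have "closed_segment (P n) (P 1) \<subseteq> perimeter n P"
      by (auto simp: perimeter_def)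
    ultimately show ?thesis
      using first last by (simp add: closed_segment_commute) blast
  qed
qed

theorem left_turns_form_convex_polygon:
  fixes P :: "nat \<Rightarrow> real \<times> real"
  assumes "2 \<le> n" and inj: "inj_on P {1..n}"
    and turns: "\<And>i j k. 1 \<le> i \<Longrightarrow> i \<le> j \<Longrightarrow> j \<le> k \<Longrightarrow> k \<le> n \<Longrightarrow> left_turn (P i) (P j) (P k)"
  shows "form_convex_polygon n P"
proof -
  let ?S = "P ` {1..n}"
  have "perimeter n P \<subseteq> frontier (convex hull ?S)"
  proof -
    have "closed_segment (P i) (P (i + 1)) \<subseteq> frontier (convex hull ?S)" if "i \<in> {1..<n}" for i
    proof (rule supporting_edge_subset_frontier)
      show "P i \<noteq> P (i + 1)" using inj_onD[OF inj, of i "i + 1"] that by auto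
      show "left_turn (P i) (P (i + 1)) C" if C: "C \<in> ?S" for C
      proof -
        obtain l where l: "C = P l" "l \<in> {1..n}" using C by blast
        show ?thesis
        proof (cases "l \<le> i")
          case True
          then show ?thesis
            using turns[of l i "i + 1"] l \<open>i \<in> {1..<n}\<close> left_turn_rotate by auto
        next
          case False
          then show ?thesis using turns[of i "i + 1" l] l \<open>i \<in> {1..<n}\<close> by auto
        qed
      qed
    qed (use that in auto)
    moreover have "closed_segment (P n) (P 1) \<subseteq> frontier (convex hull ?S)"
    proof (rule supporting_edge_subset_frontier)
      show "P n \<noteq> P 1" using inj_onD[OF inj, of n 1] \<open>2 \<le> n\<close> by auto
      show "left_turn (P n) (P 1) C" if "C \<in> ?S" for C
        using that turns[of 1 _ n] by (auto simp: left_turn_rotate[of "P n" "P (Suc 0)"])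
    qed (use \<open>2 \<le> n\<close> in auto)
    ultimately show ?thesis
      unfolding perimeter_def by (intro Un_least UN_least)
  qed
  moreover have "frontier (convex hull ?S) \<subseteq> perimeter n P"
  proof
    fix z assume z: "z \<in> frontier (convex hull ?S)"
    have "finite ?S" by simp
    then obtain a A C where a: "a \<noteq> 0" "\<forall>w\<in>?S. a \<bullet> z \<le> a \<bullet> w"
      and AC: "A \<in> ?S" "C \<in> ?S" "a \<bullet> A = a \<bullet> z" "a \<bullet> C = a \<bullet> z" "z \<in> closed_segment A C"
      using z by (rule frontier_convex_hull_on_supporting_chord)
    obtain j k where jk: "j \<in> {1..n}" "k \<in> {1..n}" "A = P j" "C = P k" using AC(1,2) by auto
    have chord: "closed_segment (P p) (P q) \<subseteq> perimeter n P"
      if "p < q" "p \<in> {1..n}" "q \<in> {1..n}" "a \<bullet> P p = a \<bullet> z" "a \<bullet> P q = a \<bullet> z" for p q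
    proof (rule supporting_chord_subset_perimeter[OF turns a(1)])
      show "P p \<noteq> P q" using inj_onD[OF inj, of p q] that by auto
    qed (use that a(2) in auto)
    consider "j = k" | "j < k" | "k < j" by linarith
    then show "z \<in> perimeter n P"
    proof cases
      case 1
      then show ?thesis using AC(5) jk vertex_in_perimeter[of k n P] by simp
    next
      case 2
      then show ?thesis using chord[of j k] AC jk by auto
    next
      case 3
      then show ?thesis using chord[of k j] AC jk by (auto simp: closed_segment_commute)
    qed
  qed
  ultimately show ?thesis
    unfolding form_convex_polygon_def perimeter_def by (rule subset_antisym)
qed

section \<open>Convex and concave coordinates\<close>

lemma convex_seq_increments_mono:
  assumes "convex_seq a b u" "a \<le> i" "i \<le> j" "j < b"
  shows "u (i + 1) - u i \<le> u (j + 1) - u j"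
  using assms(3,4)
proof (induction j rule: dec_induct)
  case base
  then show ?case by simp
next
  case (step j)
  have "2 * u (Suc j) \<le> u j + u (Suc (Suc j))"
    using assms(1,2) step by (auto simp: convex_seq_def dest!: spec[of _ "Suc j"])
  then show ?case using step by simp
qed

lemma concave_seq_increments_antimono:
  assumes "concave_seq a b u" "a \<le> i" "i \<le> j" "j < b"
  shows "u (j + 1) - u j \<le> u (i + 1) - u i"
proof -
  have "convex_seq a b (\<lambda>i. - u i)"
    using assms(1) by (auto simp: convex_seq_def concave_seq_def algebra_simps)
  from convex_seq_increments_mono[OF this assms(2-4)] show ?thesis by simp
qed

lemma cross_edges_nonneg:
  fixes x y :: "nat \<Rightarrow> real"
  assumes y: "convex_seq 1 n y" and min: "m \<in> {1..n}" "\<And>i. i \<in> {1..n} \<Longrightarrow> y m \<le> y i"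
    and x: "increasing_seq 1 n x" "convex_seq 1 m x" "concave_seq m n x"
    and pq: "1 \<le> p" "p < q" "q < n"
  shows "0 \<le> cross2 ((x (p + 1), y (p + 1)) - (x p, y p)) ((x (q + 1), y (q + 1)) - (x q, y q))"
proof -
  define dx where "dx i = x (i + 1) - x i" for i
  define dy where "dy i = y (i + 1) - y i" for i
  have dx0: "0 \<le> dx p" "0 \<le> dx q"
    using x(1) pq by (auto simp: increasing_seq_def dx_def)
  have dy_mono: "dy p \<le> dy q"
    unfolding dy_def by (rule convex_seq_increments_mono[OF y]) (use pq in auto)
  have falling: "dy i \<le> 0" if "1 \<le> i" "i < m" for i
  proof -
    have "dy i \<le> dy (m - 1)"
      unfolding dy_def by (rule convex_seq_increments_mono[OF y]) (use that min(1) in auto)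
    moreover have "m - 1 \<in> {1..n}" using that min(1) by auto
    then have "dy (m - 1) \<le> 0" using min(2)[of "m - 1"] that by (simp add: dy_def)
    ultimately show ?thesis by simp
  qed
  have rising: "0 \<le> dy i" if "m \<le> i" "i < n" for i
  proof -
    have "0 \<le> dy m" using min(2)[of "m + 1"] that min(1) by (auto simp: dy_def)
    also have "\<dots> \<le> dy i"
      unfolding dy_def by (rule convex_seq_increments_mono[OF y]) (use that min(1) in auto)
    finally show ?thesis .
  qed
  consider "q < m" | "p < m" "m \<le> q" | "m \<le> p" by linarith
  then have "dy p * dx q \<le> dx p * dy q"
  proof cases
    case 1
    have "dx p \<le> dx q"
      unfolding dx_def by (rule convex_seq_increments_mono[OF x(2)]) (use pq 1 in auto)
    have "dy p * dx q \<le> dy q * dx q"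
      using dy_mono dx0 by (intro mult_right_mono)
    also have "\<dots> \<le> dy q * dx p"
      using \<open>dx p \<le> dx q\<close> falling[of q] pq 1 by (intro mult_left_mono_neg) auto
    finally show ?thesis by (simp add: mult.commute)
  next
    case 2
    have "dy p * dx q \<le> 0" using falling[of p] pq 2 dx0 by (auto simp: mult_nonpos_nonneg)
    also have "0 \<le> dx p * dy q" using rising[of q] pq 2 dx0 by auto
    finally show ?thesis .
  next
    case 3
    have "dx q \<le> dx p"
      unfolding dx_def by (rule concave_seq_increments_antimono[OF x(3)]) (use pq 3 in auto)
    have "dy p * dx q \<le> dy p * dx p"
      using \<open>dx q \<le> dx p\<close> rising[of p] pq 3 by (intro mult_left_mono) auto
    also have "\<dots> \<le> dy q * dx p"
      using dy_mono dx0 by (intro mult_right_mono)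
    finally show ?thesis by (simp add: mult.commute)
  qed
  then show ?thesis by (simp add: cross2_def dx_def dy_def)
qed

theorem theorem2p6:
  fixes n m :: nat and x y :: "nat \<Rightarrow> real"
  assumes "n \<ge> 3"
    and "inj_on (\<lambda>i. (x i, y i)) {1..n}"
    and "convex_seq 1 n y"
    and "m \<in> {1..n}"
    and "Min (y ` {1..n}) = y m"
    and "increasing_seq 1 n x"
    and "convex_seq 1 m x"
    and "concave_seq m n x"
  shows "form_convex_polygon n (\<lambda>i. (x i, y i))"
proof (rule left_turns_form_convex_polygon)
  show "2 \<le> n" using assms(1) by simp
  have min: "y m \<le> y i" if "i \<in> {1..n}" for i
    unfolding assms(5)[symmetric] using that by (intro Min_le) auto
  show "left_turn (x i, y i) (x j, y j) (x k, y k)"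
    if "1 \<le> i" "i \<le> j" "j \<le> k" "k \<le> n" for i j k
    using left_turn_of_edges[of 1 n "\<lambda>i. (x i, y i)",
        OF cross_edges_nonneg[OF assms(3,4) min assms(6-8)] that]
    by simp
qed (rule assms(2))

end
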